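(* Let $q\ge 1$ and $n\ge 0$ be integers. Then for every integer $k\ge 1$, $$a(n+1,k)=a(n-q+1,k-1)+(n-qk+1)\,a(n,k)-a(n-q+1,k)+q(k+1)\,a(n,k+1).$$
   Context: $S_n$ is the set of all permutations of $[n]=\{1,2,\ldots,n\}$ (with $S_0$ consisting of the single empty permutation). For a fixed integer $q\ge 1$, an adjacent $q$-cycle (A$q$C) of a permutation $\pi\in S_n$ is a cycle of length $q$ in the disjoint cycle decomposition of $\pi$ of the form $(a,a+1,a+2,\ldots,a+q-1)$, i.e. $\pi(a+i)=a+i+1$ for $0\le i\le q-2$ and $\pi(a+q-1)=a$ (for $q=1$ this is a fixed point). For fixed $q$, $a(n,k)$ denotes the number of permutations $\pi\in S_n$ having exactly $k$ A$q$C's; in particular $a(n,k)=0$ if $k>\lfloor n/q\rfloor$. Convention: $a(m,j)=0$ for $m<0$. *)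

theory Defs
  imports Complex_Main "HOL-Combinatorics.Permutations"
begin

text \<open>A cycle \<open>(a, a+1, \<dots>, a+q-1)\<close> is represented by the list of its elements, least element
  first. For \<open>q \<ge> 1\<close> this list determines and is determined by the cycle.\<close>

definition adjacent_cycles :: "nat \<Rightarrow> nat \<Rightarrow> (nat \<Rightarrow> nat) \<Rightarrow> nat list set" where
  "adjacent_cycles q n \<pi> =
     {[a..<a + q] | a. {a..<a + q} \<subseteq> {1..n} \<and>
        (\<forall>i. i + 1 < q \<longrightarrow> \<pi> (a + i) = a + i + 1) \<and> \<pi> (a + q - 1) = a}"

text \<open>The size \<open>m\<close> is an integer to accommodate the convention that the number is \<open>0\<close> for
  \<open>m < 0\<close>. For \<open>m = 0\<close> the only permutation counted is the identity, playing the role of the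
  empty permutation.\<close>

definition num_perms :: "nat \<Rightarrow> int \<Rightarrow> nat \<Rightarrow> int" where
  "num_perms q m k =
     (if m < 0 then 0
      else int (card {\<pi>. \<pi> permutes {1..nat m} \<and> card (adjacent_cycles q (nat m) \<pi>) = k}))"

end

theory Submission imports Defs begin

text \<open>
  Every permutation of \<open>{1..n+1}\<close> arises exactly once from a permutation \<open>\<pi>\<close> of \<open>{1..n}\<close> by
  inserting the point \<open>n + 1\<close> into a cycle just before some \<open>b \<le> n\<close>, or as a fixed point, which is
  the case \<open>b = n + 1\<close>. Such an insertion destroys the adjacent \<open>q\<close>-cycle of \<open>\<pi>\<close> containing \<open>b\<close>, if
  there is one, and keeps all the others (\<open>cycle_starts_insert_point\<close>). The adjacent \<open>q\<close>-cycles are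
  disjoint, so if \<open>\<pi>\<close> has \<open>c\<close> of them, then \<open>q c\<close> of the \<open>n + 1\<close> choices of \<open>b\<close> leave \<open>c - 1\<close>, and
  the other \<open>n + 1 - q c\<close> choices leave \<open>c\<close>. Call an adjacent \<open>q\<close>-cycle of the extended permutation
  low if it avoids \<open>n + 1\<close>. Summing over \<open>\<pi>\<close>, the number \<open>E(k)\<close> of permutations of \<open>{1..n+1}\<close> with
  exactly \<open>k\<close> low cycles is
  \<open>(n - q k + 1) a(n, k) + q (k + 1) a(n, k + 1)\<close> (\<open>card_extensions\<close>).

  The only adjacent \<open>q\<close>-cycle that is not low is the one on the last block \<open>{n-q+2..n+1}\<close>.
  Deleting that block shows that the permutations having this cycle and \<open>j\<close> low ones are
  counted by \<open>T(j) = a(n - q + 1, j)\<close> (\<open>card_with_last_block\<close>). A permutation with \<open>k\<close> adjacent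
  \<open>q\<close>-cycles in all either has the last block and \<open>k - 1\<close> low cycles, or lacks the last block and has
  \<open>k\<close> low ones. Hence \<open>a(n + 1, k) = T(k - 1) + (E(k) - T(k))\<close>, which is the recurrence.
\<close>

section \<open>Adjacent cycles as intervals\<close>

definition is_adj_cycle :: "nat \<Rightarrow> (nat \<Rightarrow> nat) \<Rightarrow> nat \<Rightarrow> bool" where
  "is_adj_cycle q \<pi> a \<longleftrightarrow> (\<forall>i. i + 1 < q \<longrightarrow> \<pi> (a + i) = a + i + 1) \<and> \<pi> (a + q - 1) = a"

definition cycle_starts :: "nat \<Rightarrow> nat \<Rightarrow> (nat \<Rightarrow> nat) \<Rightarrow> nat set" where
  "cycle_starts q n \<pi> = {a. {a..<a + q} \<subseteq> {1..n} \<and> is_adj_cycle q \<pi> a}"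

lemma finite_cycle_starts:
  assumes "q \<ge> 1"
  shows "finite (cycle_starts q n \<pi>)"
proof (rule finite_subset)
  show "cycle_starts q n \<pi> \<subseteq> {1..n}"
    using assms by (auto simp: cycle_starts_def subset_iff)
qed simp

lemma card_adjacent_cycles:
  assumes "q \<ge> 1"
  shows "card (adjacent_cycles q n \<pi>) = card (cycle_starts q n \<pi>)"
proof -
  have "adjacent_cycles q n \<pi> = (\<lambda>a. [a..<a + q]) ` cycle_starts q n \<pi>"
    by (auto simp: adjacent_cycles_def cycle_starts_def is_adj_cycle_def)
  moreover have "inj_on (\<lambda>a. [a..<a + q]) (cycle_starts q n \<pi>)"
  proof (rule inj_onI)
    fix a b :: nat
    assume "[a..<a + q] = [b..<b + q]"
    then have "hd [a..<a + q] = hd [b..<b + q]" by simp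
    then show "a = b" using assms by (simp add: hd_upt)
  qed
  ultimately show ?thesis by (simp add: card_image)
qed

lemma is_adj_cycle_cong:
  assumes "\<And>x. x \<in> {a..<a + q} \<Longrightarrow> \<pi> x = \<sigma> x" "q \<ge> 1"
  shows "is_adj_cycle q \<pi> a \<longleftrightarrow> is_adj_cycle q \<sigma> a"
  using assms by (auto simp: is_adj_cycle_def)

lemma is_adj_cycle_apply:
  assumes "is_adj_cycle q \<pi> a" "x \<in> {a..<a + q}"
  shows "\<pi> x = (if x = a + q - 1 then a else x + 1)"
proof (cases "x = a + q - 1")
  case False
  from assms(2) obtain i where "x = a + i" "i < q"
    by (metis atLeastLessThan_iff le_Suc_ex nat_add_left_cancel_less)
  with assms(1) False show ?thesis by (auto simp: is_adj_cycle_def)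
qed (use assms in \<open>auto simp: is_adj_cycle_def\<close>)

lemma is_adj_cycle_image:
  assumes "is_adj_cycle q \<pi> a" "q \<ge> 1"
  shows "\<pi> ` {a..<a + q} = {a..<a + q}"
proof (rule endo_inj_surj)
  show "\<pi> ` {a..<a + q} \<subseteq> {a..<a + q}"
    using assms is_adj_cycle_apply[OF assms(1)] by auto
  show "inj_on \<pi> {a..<a + q}"
    using is_adj_cycle_apply[OF assms(1)] by (auto simp: inj_on_def split: if_splits)
qed simp

text \<open>If \<open>b\<close> starts an adjacent cycle and lies strictly inside the one starting at \<open>a\<close>, then both
  \<open>b - 1\<close> and \<open>b + q - 1\<close> are preimages of \<open>b\<close>.\<close>

lemma is_adj_cycle_disjoint:
  assumes "inj \<pi>" "is_adj_cycle q \<pi> a" "is_adj_cycle q \<pi> b" "a \<noteq> b"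
  shows "{a..<a + q} \<inter> {b..<b + q} = {}"
proof -
  have *: False if "is_adj_cycle q \<pi> a" "is_adj_cycle q \<pi> b" "a < b" "b < a + q" for a b
  proof -
    have "b - 1 \<in> {a..<a + q}" "b - 1 \<noteq> a + q - 1" "b - 1 + 1 = b" using that(3,4) by auto
    then have "\<pi> (b - 1) = b"
      using is_adj_cycle_apply[OF that(1)] by presburger
    moreover have "\<pi> (b + q - 1) = b"
      using that(2) by (simp add: is_adj_cycle_def)
    ultimately have "b - 1 = b + q - 1"
      using assms(1) by (metis injD)
    then show False using that(3,4) by simp
  qed
  show ?thesis
    using *[of a b] *[of b a] assms(2-4) by (cases a b rule: linorder_cases) auto
qed

section \<open>Inserting the point \<open>n + 1\<close>\<close>

text \<open>Composing with \<open>transpose (n + 1) b\<close> redirects the arrow that enters \<open>b\<close> to \<open>n + 1\<close>, and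
  \<open>n + 1\<close> to \<open>b\<close>. So the values on an interval below \<open>n + 1\<close> change only if \<open>b\<close> is among them, and
  then \<open>n + 1\<close> becomes a value; an adjacent cycle, whose interval is its own image, survives
  exactly when it misses \<open>b\<close>. In particular no cycle inside \<open>{1..n}\<close> is created.\<close>

lemma cycle_starts_insert_point:
  assumes \<pi>: "\<pi> permutes {1..n}" and q: "q \<ge> 1"
  shows "cycle_starts q n (transpose (n + 1) b \<circ> \<pi>) = {a \<in> cycle_starts q n \<pi>. b \<notin> {a..<a + q}}"
    (is "cycle_starts q n ?\<sigma> = _")
proof (intro equalityI subsetI)
  fix a assume "a \<in> cycle_starts q n ?\<sigma>"
  then have sub: "{a..<a + q} \<subseteq> {1..n}" and adj: "is_adj_cycle q ?\<sigma> a"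
    by (auto simp: cycle_starts_def)
  have ne: "\<pi> x \<noteq> b \<and> ?\<sigma> x = \<pi> x" if "x \<in> {a..<a + q}" for x
  proof -
    have "?\<sigma> x \<in> {a..<a + q}" using is_adj_cycle_image[OF adj q] that by blast
    then have "?\<sigma> x \<noteq> n + 1" using sub by auto
    moreover have "\<pi> x \<in> {1..n}" using that sub permutes_in_image[OF \<pi>] by blast
    ultimately show ?thesis by (auto simp: transpose_def split: if_splits)
  qed
  then have adj': "is_adj_cycle q \<pi> a"
    using is_adj_cycle_cong[of a q ?\<sigma> \<pi>] adj q by blast
  moreover have "b \<notin> {a..<a + q}"
    using is_adj_cycle_image[OF adj' q] ne by (metis imageE)
  ultimately show "a \<in> {a \<in> cycle_starts q n \<pi>. b \<notin> {a..<a + q}}"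
    using sub by (simp add: cycle_starts_def)
next
  fix a assume a: "a \<in> {a \<in> cycle_starts q n \<pi>. b \<notin> {a..<a + q}}"
  then have sub: "{a..<a + q} \<subseteq> {1..n}" and adj: "is_adj_cycle q \<pi> a" and b: "b \<notin> {a..<a + q}"
    by (auto simp: cycle_starts_def)
  have "\<pi> x = ?\<sigma> x" if "x \<in> {a..<a + q}" for x
  proof -
    have "\<pi> x \<in> {a..<a + q}" using is_adj_cycle_image[OF adj q] that by blast
    then have "\<pi> x \<noteq> n + 1" "\<pi> x \<noteq> b" using sub b by auto
    then show ?thesis by (simp add: transpose_def)
  qed
  then have "is_adj_cycle q ?\<sigma> a"
    using is_adj_cycle_cong[of a q \<pi> ?\<sigma>] adj q by blast
  then show "a \<in> cycle_starts q n ?\<sigma>" using sub by (simp add: cycle_starts_def)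
qed

text \<open>The right-hand side may be written without truncated subtraction because the disjoint
  intervals fit into \<open>{1..n}\<close>, so that \<open>q k \<le> n\<close> whenever \<open>\<pi>\<close> has \<open>k\<close> adjacent cycles.\<close>

lemma card_insertion_points:
  assumes \<pi>: "\<pi> permutes {1..n}" and q: "q \<ge> 1"
  shows "int (card {b \<in> {1..n + 1}. card (cycle_starts q n (transpose (n + 1) b \<circ> \<pi>)) = k}) =
    (if card (cycle_starts q n \<pi>) = k then int n - int q * int k + 1 else 0) +
    (if card (cycle_starts q n \<pi>) = k + 1 then int q * (int k + 1) else 0)"
proof -
  define S where "S = cycle_starts q n \<pi>"
  define D where "D = (\<Union>a\<in>S. {a..<a + q})"
  have fin: "finite S" unfolding S_def by (rule finite_cycle_starts[OF q])
  have disj: "{a..<a + q} \<inter> {b..<b + q} = {}" if "a \<in> S" "b \<in> S" "a \<noteq> b" for a b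
    using that is_adj_cycle_disjoint[OF permutes_inj[OF \<pi>]] by (simp add: S_def cycle_starts_def)
  have "card D = (\<Sum>a\<in>S. card {a..<a + q})"
    unfolding D_def by (intro card_UN_disjoint ballI impI disj) (use fin in auto)
  then have cD: "card D = q * card S" by simp
  have D: "D \<subseteq> {1..n}" by (auto simp: D_def S_def cycle_starts_def)
  have out: "card (cycle_starts q n (transpose (n + 1) b \<circ> \<pi>)) = card S" if "b \<notin> D" for b
  proof -
    have "{a \<in> S. b \<notin> {a..<a + q}} = S" using that by (auto simp: D_def)
    then show ?thesis using cycle_starts_insert_point[OF \<pi> q, of b] by (simp add: S_def)
  qed
  have inD: "card (cycle_starts q n (transpose (n + 1) b \<circ> \<pi>)) + 1 = card S" if "b \<in> D" for b
  proof -
    obtain a where a: "a \<in> S" "b \<in> {a..<a + q}" using \<open>b \<in> D\<close> by (auto simp: D_def)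
    then have "{a \<in> S. b \<notin> {a..<a + q}} = S - {a}" using disj by blast
    then show ?thesis
      using cycle_starts_insert_point[OF \<pi> q, of b] a fin card_Suc_Diff1[OF fin a(1)]
      by (simp add: S_def)
  qed
  consider "card S = k" | "card S = k + 1" | "card S \<noteq> k" "card S \<noteq> k + 1" by blast
  then show ?thesis
  proof cases
    case 1
    have "{b \<in> {1..n + 1}. card (cycle_starts q n (transpose (n + 1) b \<circ> \<pi>)) = k} = {1..n + 1} - D"
      using out inD 1 by fastforce
    moreover have "card ({1..n + 1} - D) = n + 1 - q * k"
      using card_Diff_subset[of D "{1..n + 1}"] D finite_subset[OF D] cD 1 by force
    moreover have "q * k \<le> n" using card_mono[OF _ D] cD 1 by simp
    ultimately show ?thesis using 1 by (simp add: S_def of_nat_diff)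
  next
    case 2
    have "{b \<in> {1..n + 1}. card (cycle_starts q n (transpose (n + 1) b \<circ> \<pi>)) = k} = D"
      using out inD 2 D by fastforce
    then show ?thesis using 2 cD by (simp add: S_def distrib_left)
  next
    case 3
    then have "card (cycle_starts q n (transpose (n + 1) b \<circ> \<pi>)) \<noteq> k" for b
      using out[of b] inD[of b] by (cases "b \<in> D") auto
    then have "{b \<in> {1..n + 1}. card (cycle_starts q n (transpose (n + 1) b \<circ> \<pi>)) = k} = {}"
      by blast
    then show ?thesis using 3 by (simp add: S_def)
  qed
qed

text \<open>The insertion \<open>(\<pi>, b) \<mapsto> transpose (n + 1) b \<circ> \<pi>\<close> is a bijection onto the permutations of
  \<open>{1..n+1}\<close>: the image of \<open>n + 1\<close> recovers \<open>b\<close>, and then \<open>\<pi>\<close>. This turns the count into a sum of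
  the previous one over \<open>\<pi>\<close>. Cycles through \<open>n + 1\<close> are left out of the count because insertion
  can create one of them, but never a cycle inside \<open>{1..n}\<close>.\<close>

lemma card_extensions:
  assumes q: "q \<ge> 1"
  shows "int (card {\<sigma>. \<sigma> permutes {1..n + 1} \<and> card (cycle_starts q n \<sigma>) = k}) =
    (int n - int q * int k + 1) * int (card {\<pi>. \<pi> permutes {1..n} \<and> card (cycle_starts q n \<pi>) = k})
    + int q * (int k + 1) * int (card {\<pi>. \<pi> permutes {1..n} \<and> card (cycle_starts q n \<pi>) = k + 1})"
proof -
  define P where "P = {\<pi>. \<pi> permutes {1..n}}"
  define ext where "ext = (\<lambda>(\<pi>, b). transpose (n + 1) b \<circ> \<pi> :: nat \<Rightarrow> nat)"
  define B where "B = (\<lambda>\<pi>. {b \<in> {1..n + 1}. card (cycle_starts q n (transpose (n + 1) b \<circ> \<pi>)) = k})"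
  have finP: "finite P" by (simp add: P_def finite_permutations)
  have fix_top: "\<pi> (n + 1) = n + 1" if "\<pi> \<in> P" for \<pi>
    using that permutes_not_in[of \<pi> "{1..n}" "n + 1"] by (simp add: P_def)
  have ins: "{1..n + 1} = insert (n + 1) {1..n}" by auto
  have inj: "inj_on ext (Sigma P B)"
  proof (rule inj_onI)
    fix x y assume xy: "x \<in> Sigma P B" "y \<in> Sigma P B" "ext x = ext y"
    obtain \<pi> b \<rho> c where [simp]: "x = (\<pi>, b)" "y = (\<rho>, c)" by fastforce
    have "ext x (n + 1) = b" "ext y (n + 1) = c"
      using xy(1,2) fix_top[of \<pi>] fix_top[of \<rho>] by (simp_all add: ext_def)
    with xy have bc: "b = c" by simp
    have "transpose (n + 1) b \<circ> (transpose (n + 1) b \<circ> \<pi>) = transpose (n + 1) b \<circ> (transpose (n + 1) b \<circ> \<rho>)"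
      using xy bc by (simp add: ext_def)
    then have "\<pi> = \<rho>" by (simp add: comp_assoc[symmetric])
    with bc show "x = y" by simp
  qed
  have img: "ext ` Sigma P B = {\<sigma>. \<sigma> permutes {1..n + 1} \<and> card (cycle_starts q n \<sigma>) = k}"
  proof (intro equalityI subsetI)
    fix \<sigma> assume "\<sigma> \<in> ext ` Sigma P B"
    then obtain \<pi> b where *: "\<pi> \<in> P" "b \<in> B \<pi>" "\<sigma> = transpose (n + 1) b \<circ> \<pi>"
      by (auto simp: ext_def)
    have "\<pi> permutes {1..n + 1}"
      using *(1) permutes_subset[of \<pi> "{1..n}" "{1..n + 1}"] by (simp add: P_def)
    moreover have "transpose (n + 1) b permutes {1..n + 1}"
      using *(2) by (intro permutes_swap_id) (auto simp: B_def)
    ultimately show "\<sigma> \<in> {\<sigma>. \<sigma> permutes {1..n + 1} \<and> card (cycle_starts q n \<sigma>) = k}"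
      using * permutes_compose by (auto simp: B_def)
  next
    fix \<sigma> assume "\<sigma> \<in> {\<sigma>. \<sigma> permutes {1..n + 1} \<and> card (cycle_starts q n \<sigma>) = k}"
    then have \<sigma>: "\<sigma> permutes {1..n + 1}" "card (cycle_starts q n \<sigma>) = k" by auto
    define \<pi> where "\<pi> = transpose (n + 1) (\<sigma> (n + 1)) \<circ> \<sigma>"
    have eq: "\<sigma> = transpose (n + 1) (\<sigma> (n + 1)) \<circ> \<pi>"
      by (simp add: \<pi>_def comp_assoc[symmetric])
    have "\<pi> \<in> P"
      unfolding P_def \<pi>_def using permutes_insert_lemma[of \<sigma> "n + 1" "{1..n}"] \<sigma>(1) ins by simp
    moreover have "\<sigma> (n + 1) \<in> {1..n + 1}"
      using permutes_in_image[OF \<sigma>(1), of "n + 1"] by simp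
    then have "\<sigma> (n + 1) \<in> B \<pi>" unfolding B_def using \<sigma>(2) eq by simp
    ultimately have "(\<pi>, \<sigma> (n + 1)) \<in> Sigma P B" by blast
    moreover have "\<sigma> = ext (\<pi>, \<sigma> (n + 1))" unfolding ext_def prod.case by (rule eq)
    ultimately show "\<sigma> \<in> ext ` Sigma P B" by (rule rev_image_eqI)
  qed
  have "int (card {\<sigma>. \<sigma> permutes {1..n + 1} \<and> card (cycle_starts q n \<sigma>) = k}) = int (card (Sigma P B))"
    using card_image[OF inj] img by simp
  also have "\<dots> = (\<Sum>\<pi>\<in>P. int (card (B \<pi>)))"
    using finP by (subst card_SigmaI) (auto simp: B_def)
  also have "\<dots> = (\<Sum>\<pi>\<in>P. (if card (cycle_starts q n \<pi>) = k then int n - int q * int k + 1 else 0) +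
      (if card (cycle_starts q n \<pi>) = k + 1 then int q * (int k + 1) else 0))"
    unfolding B_def by (intro sum.cong refl card_insertion_points q) (simp add: P_def)
  also have "\<dots> = (\<Sum>\<pi> | \<pi> \<in> P \<and> card (cycle_starts q n \<pi>) = k. int n - int q * int k + 1) +
      (\<Sum>\<pi> | \<pi> \<in> P \<and> card (cycle_starts q n \<pi>) = k + 1. int q * (int k + 1))"
    unfolding sum.inter_filter[OF finP] by (rule sum.distrib)
  finally show ?thesis by (simp add: P_def)
qed

section \<open>Adjacent cycles through the last point\<close>

lemma ex_cyclic_shift:
  assumes "q \<ge> 1"
  obtains c where "c permutes {a..<a + q}" "is_adj_cycle q c a"
proof
  define c where "c = (\<lambda>x. if x \<in> {a..<a + q} then if x = a + q - 1 then a else x + 1 else x)"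
  show adj: "is_adj_cycle q c a"
    using assms by (auto simp: is_adj_cycle_def c_def)
  have "inj_on c {a..<a + q}"
    by (auto simp: inj_on_def c_def split: if_splits)
  then have "bij_betw c {a..<a + q} {a..<a + q}"
    using is_adj_cycle_image[OF adj assms] by (simp add: bij_betw_def)
  then show "c permutes {a..<a + q}"
    by (rule bij_imp_permutes) (auto simp: c_def)
qed

text \<open>Composition with a fixed cyclic shift \<open>c\<close> of \<open>{m+1..m+q}\<close> maps the permutations of \<open>{1..m}\<close>
  bijectively onto the permutations of \<open>{1..m+q}\<close> with an adjacent cycle on that block. Every other
  adjacent cycle is disjoint from the block, so it lies in \<open>{1..m}\<close>; this is why counting
  up to \<open>m + q - 1\<close> and counting up to \<open>m\<close> agree.\<close>

lemma card_with_last_block: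
  assumes q: "q \<ge> 1"
  shows "card {\<sigma>. \<sigma> permutes {1..m + q} \<and> is_adj_cycle q \<sigma> (m + 1)
            \<and> card (cycle_starts q (m + q - 1) \<sigma>) = k}
       = card {\<rho>. \<rho> permutes {1..m} \<and> card (cycle_starts q m \<rho>) = k}"
proof -
  let ?K = "{m + 1..<m + 1 + q}"
  obtain c where c: "c permutes ?K" "is_adj_cycle q c (m + 1)"
    by (rule ex_cyclic_shift[OF q])
  have starts: "cycle_starts q (m + q - 1) (\<rho> \<circ> c) = cycle_starts q m \<rho>"
    and adj: "is_adj_cycle q (\<rho> \<circ> c) (m + 1)"
    and perm: "\<rho> \<circ> c permutes {1..m + q}" if \<rho>: "\<rho> permutes {1..m}" for \<rho>
  proof -
    have "(\<rho> \<circ> c) x = c x" if "x \<in> ?K" for x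
      using permutes_not_in[OF \<rho>, of "c x"] permutes_in_image[OF c(1), of x] that by auto
    then show adj: "is_adj_cycle q (\<rho> \<circ> c) (m + 1)"
      using is_adj_cycle_cong[of "m + 1" q "\<rho> \<circ> c" c] c(2) q by blast
    show perm: "\<rho> \<circ> c permutes {1..m + q}"
      by (intro permutes_compose permutes_subset[OF c(1)] permutes_subset[OF \<rho>]) auto
    have agree: "is_adj_cycle q (\<rho> \<circ> c) a \<longleftrightarrow> is_adj_cycle q \<rho> a" if "{a..<a + q} \<subseteq> {1..m}" for a
    proof (rule is_adj_cycle_cong[OF _ q])
      fix x assume "x \<in> {a..<a + q}"
      then show "(\<rho> \<circ> c) x = \<rho> x" using permutes_not_in[OF c(1), of x] that by force
    qed
    have low: "{a..<a + q} \<subseteq> {1..m}"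
      if "{a..<a + q} \<subseteq> {1..m + q - 1}" "is_adj_cycle q (\<rho> \<circ> c) a" for a
    proof -
      have "a + q - 1 \<in> {1..m + q - 1}" using that(1) q by (auto simp: subset_iff)
      then have "a \<noteq> m + 1" using q by auto
      then have "{a..<a + q} \<inter> ?K = {}"
        using is_adj_cycle_disjoint[OF permutes_inj[OF perm] that(2) adj] by simp
      then show ?thesis using that(1) by fastforce
    qed
    have "{1..m} \<subseteq> {1..m + q - 1}" using q by auto
    then show "cycle_starts q (m + q - 1) (\<rho> \<circ> c) = cycle_starts q m \<rho>"
      using low agree unfolding cycle_starts_def by blast
  qed
  have "bij_betw (\<lambda>\<rho>. \<rho> \<circ> c) {\<rho>. \<rho> permutes {1..m} \<and> card (cycle_starts q m \<rho>) = k}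
      {\<sigma>. \<sigma> permutes {1..m + q} \<and> is_adj_cycle q \<sigma> (m + 1) \<and> card (cycle_starts q (m + q - 1) \<sigma>) = k}"
    (is "bij_betw _ ?R ?S")
  proof (rule bij_betw_imageI)
    show "inj_on (\<lambda>\<rho>. \<rho> \<circ> c) ?R"
    proof (rule inj_onI)
      fix \<rho> \<rho>' assume "\<rho> \<circ> c = \<rho>' \<circ> c"
      then have "\<rho> \<circ> c \<circ> inv c = \<rho>' \<circ> c \<circ> inv c" by simp
      then show "\<rho> = \<rho>'" by (simp only: comp_assoc permutes_inv_o[OF c(1)] comp_id)
    qed
    show "(\<lambda>\<rho>. \<rho> \<circ> c) ` ?R = ?S"
    proof (intro equalityI subsetI)
      fix \<sigma> assume \<sigma>: "\<sigma> \<in> ?S"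
      define \<rho> where "\<rho> = \<sigma> \<circ> inv c"
      have eq: "\<sigma> = \<rho> \<circ> c" by (simp add: \<rho>_def comp_assoc permutes_inv_o[OF c(1)])
      have "\<rho> permutes {1..m + q}" unfolding \<rho>_def
        using \<sigma> by (intro permutes_compose permutes_subset[OF permutes_inv[OF c(1)]]) auto
      moreover have "\<rho> y = y" if "y \<in> {1..m + q} - {1..m}" for y
      proof -
        have y: "y \<in> ?K" using that by auto
        then have x: "inv c y \<in> ?K" using permutes_in_image[OF permutes_inv[OF c(1)]] by blast
        have "\<sigma> (inv c y) = c (inv c y)"
          using is_adj_cycle_apply[OF _ x, of \<sigma>] is_adj_cycle_apply[OF c(2) x] \<sigma> by simp
        then show ?thesis by (simp add: \<rho>_def permutes_inverses[OF c(1)])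
      qed
      ultimately have "\<rho> permutes {1..m}" by (metis permutes_superset)
      then show "\<sigma> \<in> (\<lambda>\<rho>. \<rho> \<circ> c) ` ?R" using eq starts[of \<rho>] \<sigma> by auto
    qed (use starts adj perm in auto)
  qed
  then show ?thesis by (simp add: bij_betw_same_card)
qed

text \<open>The block ending at \<open>n + 1\<close> starts at \<open>n + 2 - q\<close>, written \<open>n + 1 - q + 1\<close> to be of the form
  \<open>m + 1\<close> with \<open>n + 1 = m + q\<close>. The guard \<open>q \<le> n + 1\<close> excludes truncation.\<close>

lemma cycle_starts_Suc:
  assumes "q \<ge> 1"
  shows "cycle_starts q (n + 1) \<sigma> = cycle_starts q n \<sigma> \<union>
    (if q \<le> n + 1 \<and> is_adj_cycle q \<sigma> (n + 1 - q + 1) then {n + 1 - q + 1} else {})"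
proof -
  have "{a..<a + q} \<subseteq> {1..n + 1} \<longleftrightarrow>
      {a..<a + q} \<subseteq> {1..n} \<or> (q \<le> n + 1 \<and> a = n + 1 - q + 1)" for a
  proof -
    have "{a..<a + q} \<subseteq> {1..N} \<longleftrightarrow> 1 \<le> a \<and> a + q \<le> N + 1" for N
    proof
      assume "{a..<a + q} \<subseteq> {1..N}"
      then have "a \<in> {1..N}" "a + q - 1 \<in> {1..N}" using assms by (auto simp: subset_iff)
      then show "1 \<le> a \<and> a + q \<le> N + 1" by auto
    qed auto
    then show ?thesis by auto
  qed
  then show ?thesis unfolding cycle_starts_def by auto
qed

section \<open>The recurrence\<close>

theorem theorem3p2:
  fixes q n k :: nat
  assumes "q \<ge> 1" and "k \<ge> 1"
  shows "num_perms q (int n + 1) k =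
           num_perms q (int n - int q + 1) (k - 1)
           + (int n - int q * int k + 1) * num_perms q (int n) k
           - num_perms q (int n - int q + 1) k
           + int q * (int k + 1) * num_perms q (int n) (k + 1)"
proof -
  define P where "P = {\<sigma>. \<sigma> permutes {1..n + 1}}"
  define low where "low = (\<lambda>\<sigma>. card (cycle_starts q n \<sigma>))"
  define top where "top = (\<lambda>\<sigma>. q \<le> n + 1 \<and> is_adj_cycle q \<sigma> (n + 1 - q + 1))"
  note q = \<open>q \<ge> 1\<close>
  have finP: "finite P" by (simp add: P_def finite_permutations)
  have num: "num_perms q (int m) j = int (card {\<pi>. \<pi> permutes {1..m} \<and> card (cycle_starts q m \<pi>) = j})"
    for m j by (simp add: num_perms_def card_adjacent_cycles[OF q])
  \<comment> \<open>For \<open>q > n + 1\<close> both sides vanish: there is no last block, and \<open>n - q + 1 < 0\<close>.\<close>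
  have last: "int (card {\<sigma> \<in> P. top \<sigma> \<and> low \<sigma> = j}) = num_perms q (int n - int q + 1) j" for j
  proof (cases "q \<le> n + 1")
    case True
    define m where "m = n + 1 - q"
    have n: "n + 1 = m + q" "m + q - 1 = n" using True q by (auto simp: m_def)
    then have m: "int n - int q + 1 = int m" by linarith
    have "{\<sigma> \<in> P. top \<sigma> \<and> low \<sigma> = j} = {\<sigma>. \<sigma> permutes {1..m + q}
        \<and> is_adj_cycle q \<sigma> (m + 1) \<and> card (cycle_starts q (m + q - 1) \<sigma>) = j}"
      unfolding n(2) P_def top_def low_def m_def[symmetric] n(1)[symmetric] using True by simp
    then show ?thesis
      by (simp only: m num card_with_last_block[OF q])
  qed (simp add: top_def num_perms_def)
  have total: "card (cycle_starts q (n + 1) \<sigma>) = low \<sigma> + (if top \<sigma> then 1 else 0)" for \<sigma>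
  proof -
    have "n + 1 - q + 1 \<notin> cycle_starts q n \<sigma>" if "q \<le> n + 1"
    proof
      assume "n + 1 - q + 1 \<in> cycle_starts q n \<sigma>"
      then have "n + 1 \<in> {1..n}" using that q by (auto simp: cycle_starts_def subset_iff)
      then show False by simp
    qed
    then show ?thesis
      unfolding cycle_starts_Suc[OF q] using finite_cycle_starts[OF q]
      by (simp add: low_def top_def)
  qed
  have "{\<sigma> \<in> P. card (cycle_starts q (n + 1) \<sigma>) = k} =
      {\<sigma> \<in> P. top \<sigma> \<and> low \<sigma> = k - 1} \<union> {\<sigma> \<in> P. \<not> top \<sigma> \<and> low \<sigma> = k}"
    using total \<open>k \<ge> 1\<close> by (auto split: if_splits)
  then have "card {\<sigma> \<in> P. card (cycle_starts q (n + 1) \<sigma>) = k} =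
      card {\<sigma> \<in> P. top \<sigma> \<and> low \<sigma> = k - 1} + card {\<sigma> \<in> P. \<not> top \<sigma> \<and> low \<sigma> = k}"
    using finP by (simp add: card_Un_disjoint disjoint_iff)
  moreover have "{\<sigma> \<in> P. low \<sigma> = k} = {\<sigma> \<in> P. top \<sigma> \<and> low \<sigma> = k} \<union> {\<sigma> \<in> P. \<not> top \<sigma> \<and> low \<sigma> = k}"
    by auto
  then have "card {\<sigma> \<in> P. low \<sigma> = k} =
      card {\<sigma> \<in> P. top \<sigma> \<and> low \<sigma> = k} + card {\<sigma> \<in> P. \<not> top \<sigma> \<and> low \<sigma> = k}"
    using finP by (simp add: card_Un_disjoint disjoint_iff)
  moreover have "int (card {\<sigma> \<in> P. low \<sigma> = k}) =
      (int n - int q * int k + 1) * num_perms q (int n) k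
      + int q * (int k + 1) * num_perms q (int n) (k + 1)"
    unfolding num using card_extensions[OF q, of n k] by (simp add: P_def low_def)
  moreover have "num_perms q (int n + 1) k = int (card {\<sigma> \<in> P. card (cycle_starts q (n + 1) \<sigma>) = k})"
    using num[of "n + 1" k] by (simp add: P_def add.commute)
  ultimately show ?thesis using last[of k] last[of "k - 1"] by linarith
qed

end
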